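(* Let $n\ge 1$ and let $S=(S[1],\dots,S[n])$ be a strategy of length $n$ in which $S[k]$ is a derangement of $[k]$ for every $2\le k\le n$. Then $[x^1]f_S(x)=1$ and $[x^2]f_S(x)=A(n,1)=2^n-n-1$; that is, exactly one permutation of $[n]$ is guessed in exactly one guess and exactly $2^n-n-1$ permutations of $[n]$ are guessed in exactly two guesses.
   Context: Permutation wordle on $[n]=\{1,\dots,n\}$: a secret permutation $\pi\in S_n$ (one-line notation) is fixed. The guesser's first guess is $\gamma_1=[1,2,\dots,n]$. After guess $\gamma_r$ the guesser learns $\mathcal{J}_r=\{i\in[n]:\gamma_r(i)=\pi(i)\}$; let $\mathcal{I}_r=[n]\setminus\mathcal{J}_r$. The game ends at the first $r$ with $\mathcal{J}_r=[n]$, and $r$ is then the number of guesses. A strategy of length $n$ is a sequence $S=(S[1],\dots,S[n])$ where $S[k]$ is a permutation of $[k]$. If the game has not ended, write $\mathcal{I}_r=\{i_1<\dots<i_k\}$ and $\sigma=S[k]$; the next guess is $\gamma_{r+1}(i)=\gamma_r(i)$ for $i\in\mathcal{J}_r$ and $\gamma_{r+1}(i_{\sigma(j)})=\gamma_r(i_j)$ for $j=1,\dots,k$. The generating function is $f_S(x)=\sum_{r\ge1}a_rx^r$, where $a_r$ is the number of $\pi\in S_n$ for which the game played with $S$ ends after exactly $r$ guesses. $A(n,1)$ is the Eulerian number (number of permutations of $[n]$ with exactly one descent), equal to $2^n-n-1$. *)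

theory Defs
  imports "HOL-Combinatorics.Permutations"
    "HOL-Computational_Algebra.Formal_Power_Series"
begin

text \<open>
  A permutation of \<open>[k]\<close> is a function \<open>p :: nat \<Rightarrow> nat\<close> with \<open>p permutes {1..k}\<close>; in particular it
  is the identity outside \<open>{1..k}\<close>.
\<close>

definition derangement :: "nat \<Rightarrow> (nat \<Rightarrow> nat) \<Rightarrow> bool" where
  "derangement k \<sigma> \<longleftrightarrow> \<sigma> permutes {1..k} \<and> (\<forall>i\<in>{1..k}. \<sigma> i \<noteq> i)"

text \<open>Only the values \<open>S k\<close> with \<open>1 \<le> k \<le> n\<close> are relevant for a strategy \<open>S\<close> of length \<open>n\<close>.\<close>

definition strategy :: "nat \<Rightarrow> (nat \<Rightarrow> nat \<Rightarrow> nat) \<Rightarrow> bool" where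
  "strategy n S \<longleftrightarrow> (\<forall>k\<in>{1..n}. S k permutes {1..k})"

definition correct_positions :: "nat \<Rightarrow> (nat \<Rightarrow> nat) \<Rightarrow> (nat \<Rightarrow> nat) \<Rightarrow> nat set" where
  "correct_positions n p g = {i\<in>{1..n}. g i = p i}"

definition wrong_positions :: "nat \<Rightarrow> (nat \<Rightarrow> nat) \<Rightarrow> (nat \<Rightarrow> nat) \<Rightarrow> nat set" where
  "wrong_positions n p g = {1..n} - correct_positions n p g"

text \<open>For \<open>A = {i_1 < \<dots> < i_k}\<close> and \<open>1 \<le> j \<le> k\<close>, this is \<open>i_j\<close> (with 1-based index \<open>j\<close>).\<close>

definition nth_smallest :: "nat set \<Rightarrow> nat \<Rightarrow> nat" where
  "nth_smallest A j = sorted_list_of_set A ! (j - 1)"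

text \<open>
  The new guess sends \<open>i_(\<sigma> j)\<close> to \<open>g (i_j)\<close>; as a function of \<open>i = i_(\<sigma> j)\<close> this requires inverting
  \<open>j \<mapsto> i_(\<sigma> j)\<close> on \<open>{1..k}\<close>. The lemma \<open>next_guess_wrong\<close> below recovers the defining equation.
  If \<open>g\<close> is correct everywhere, the guess is repeated.
\<close>

definition next_guess :: "nat \<Rightarrow> (nat \<Rightarrow> nat \<Rightarrow> nat) \<Rightarrow> (nat \<Rightarrow> nat) \<Rightarrow> (nat \<Rightarrow> nat) \<Rightarrow> nat \<Rightarrow> nat" where
  "next_guess n S p g i =
    (let I = wrong_positions n p g; k = card I; \<sigma> = S k in
     if i \<in> I
     then g (nth_smallest I (inv_into {1..k} (\<lambda>j. nth_smallest I (\<sigma> j)) i))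
     else g i)"

text \<open>The \<open>r\<close>-th guess, for \<open>r \<ge> 1\<close>.\<close>

definition guess :: "nat \<Rightarrow> (nat \<Rightarrow> nat \<Rightarrow> nat) \<Rightarrow> (nat \<Rightarrow> nat) \<Rightarrow> nat \<Rightarrow> nat \<Rightarrow> nat" where
  "guess n S p r = (next_guess n S p ^^ (r - 1)) id"

definition ends_after :: "nat \<Rightarrow> (nat \<Rightarrow> nat \<Rightarrow> nat) \<Rightarrow> (nat \<Rightarrow> nat) \<Rightarrow> nat \<Rightarrow> bool" where
  "ends_after n S p r \<longleftrightarrow>
    r \<ge> 1 \<and> correct_positions n p (guess n S p r) = {1..n} \<and>
    (\<forall>q\<in>{1..<r}. correct_positions n p (guess n S p q) \<noteq> {1..n})"

definition guessed_in :: "nat \<Rightarrow> (nat \<Rightarrow> nat \<Rightarrow> nat) \<Rightarrow> nat \<Rightarrow> (nat \<Rightarrow> nat) set" where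
  "guessed_in n S r = {p. p permutes {1..n} \<and> ends_after n S p r}"

text \<open>
  The coefficient of \<open>x\<^sup>0\<close> vanishes, since \<open>ends_after\<close> requires \<open>r \<ge> 1\<close>. Secret permutations
  for which the game never ends do not contribute.
\<close>

definition strategy_gf :: "nat \<Rightarrow> (nat \<Rightarrow> nat \<Rightarrow> nat) \<Rightarrow> int fps" where
  "strategy_gf n S = Abs_fps (\<lambda>r. int (card (guessed_in n S r)))"

definition descents :: "nat \<Rightarrow> (nat \<Rightarrow> nat) \<Rightarrow> nat set" where
  "descents n p = {i\<in>{1..<n}. p i > p (i + 1)}"

definition eulerian :: "nat \<Rightarrow> nat \<Rightarrow> nat" where
  "eulerian n m = card {p. p permutes {1..n} \<and> card (descents n p) = m}"

lemma bij_betw_nth_smallest: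
  assumes "finite A"
  shows "bij_betw (nth_smallest A) {1..card A} A"
proof -
  have "bij_betw (\<lambda>j. j - 1) {1..card A} {..<card A}"
    by (rule bij_betw_byWitness[where f' = Suc]) auto
  moreover have "bij_betw ((!) (sorted_list_of_set A)) {..<card A} A"
    using assms by (intro bij_betw_nth) auto
  ultimately have "bij_betw ((!) (sorted_list_of_set A) \<circ> (\<lambda>j. j - 1)) {1..card A} A"
    by (rule bij_betw_trans)
  then show ?thesis
    by (simp add: nth_smallest_def[abs_def] comp_def)
qed

lemma nth_smallest_less:
  assumes "finite A" "1 \<le> j" "j < l" "l \<le> card A"
  shows "nth_smallest A j < nth_smallest A l"
proof -
  have "sorted_wrt (<) (sorted_list_of_set A)"
    by (rule strict_sorted_list_of_set)
  then show ?thesis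
    using assms by (auto simp: nth_smallest_def sorted_wrt_iff_nth_less)
qed

lemma next_guess_correct:
  assumes "i \<in> correct_positions n p g"
  shows "next_guess n S p g i = g i"
  using assms by (simp add: next_guess_def wrong_positions_def Let_def)

lemma next_guess_wrong:
  fixes n S p g
  defines "I \<equiv> wrong_positions n p g"
  assumes "strategy n S" "j \<in> {1..card I}"
  shows "next_guess n S p g (nth_smallest I (S (card I) j)) = g (nth_smallest I j)"
proof -
  have fin: "finite I" and sub: "I \<subseteq> {1..n}"
    by (auto simp: I_def wrong_positions_def)
  have "card I \<le> n"
    using card_mono[OF _ sub] by simp
  with assms have perm: "S (card I) permutes {1..card I}"
    by (auto simp: strategy_def)
  have "bij_betw (nth_smallest I \<circ> S (card I)) {1..card I} I"
    using permutes_imp_bij[OF perm] bij_betw_nth_smallest[OF fin] by (rule bij_betw_trans)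
  then have bij: "bij_betw (\<lambda>j. nth_smallest I (S (card I) j)) {1..card I} I"
    by (simp add: comp_def)
  have "nth_smallest I (S (card I) j) \<in> I"
    using bij_betwE[OF bij] assms(3) by blast
  moreover have "inv_into {1..card I} (\<lambda>j. nth_smallest I (S (card I) j))
      (nth_smallest I (S (card I) j)) = j"
    using inv_into_f_f[OF bij_betw_imp_inj_on[OF bij] assms(3)] by simp
  ultimately show ?thesis
    by (simp add: next_guess_def Let_def flip: I_def)
qed

end

theory Submission
  imports Defs
begin

text \<open>
  The second guess depends only on the set \<open>I\<close> of positions that the secret permutation moves. If the
  strategy consists of derangements, the second guess built from \<open>I\<close> moves exactly \<open>I\<close>, so
  the permutations guessed in exactly two guesses correspond to the subsets of \<open>{1..n}\<close> with at
  least two elements. A permutation whose only descent is \<open>d\<close> is determined by the image of \<open>{1..d}\<close>,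
  and the images that occur are the subsets that are not initial segments.
\<close>

section \<open>Increasing enumerations and permutations without descents\<close>

text \<open>A strictly sorted list is determined by its set of entries, so the values of
  \<open>f\<close> in order must form \<open>sorted_list_of_set A\<close>.\<close>

lemma nth_smallest_unique:
  assumes "strict_mono_on {1..k} f" "f ` {1..k} = A" "j \<in> {1..k}"
  shows "nth_smallest A j = f j"
proof -
  have "sorted_wrt (<) (map f [1..<Suc k])"
    using assms(1) by (auto simp: sorted_wrt_iff_nth_less strict_mono_on_def simp del: upt_Suc)
  moreover have "set (map f [1..<Suc k]) = A"
    using assms(2) by (simp add: atLeastLessThanSuc_atLeastAtMost del: upt_Suc)
  ultimately have "sorted_list_of_set A = map f [1..<Suc k]"
    by (metis strict_sorted_equal strict_sorted_list_of_set List.finite_set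
        set_sorted_list_of_set)
  then show ?thesis
    using assms(3) by (auto simp: nth_smallest_def simp del: upt_Suc)
qed

lemma strict_mono_on_atLeastAtMost_Suc:
  fixes f :: "nat \<Rightarrow> 'a :: order"
  assumes "\<And>i. a \<le> i \<Longrightarrow> i < b \<Longrightarrow> f i < f (Suc i)"
  shows "strict_mono_on {a..b} f"
proof (rule strict_mono_onI)
  fix i j assume "i \<in> {a..b}" "j \<in> {a..b}" "i < j"
  from this(3,1,2) show "f i < f j"
  proof (induction rule: strict_inc_induct)
    case (base i)
    then show ?case using assms by auto
  next
    case (step i)
    then have "f i < f (Suc i)" "f (Suc i) < f j"
      using assms by auto
    then show ?case by (rule less_trans)
  qed
qed

text \<open>Injectivity excludes equal neighbours. The left side has the form used to prove
  monotonicity, the right side the form found in \<open>descents\<close>.\<close>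

lemma permutes_ascent_iff:
  fixes p :: "nat \<Rightarrow> nat"
  assumes "p permutes A"
  shows "p i < p (Suc i) \<longleftrightarrow> \<not> p i > p (i + 1)"
proof -
  have "p i \<noteq> p (Suc i)"
    using permutes_inj[OF assms] by (simp add: inj_eq)
  then show ?thesis by auto
qed

text \<open>Both \<open>p\<close> and the identity enumerate \<open>{1..n}\<close> increasingly, and
  such an enumeration is unique.\<close>

lemma strict_mono_on_permutes_id:
  fixes p :: "nat \<Rightarrow> nat"
  assumes "p permutes {1..n}" "strict_mono_on {1..n} p"
  shows "p = id"
proof
  fix i
  show "p i = id i"
  proof (cases "i \<in> {1..n}")
    case True
    have "nth_smallest {1..n} i = p i"
      using nth_smallest_unique[OF assms(2) permutes_image[OF assms(1)] True] .
    moreover have "nth_smallest {1..n} i = i"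
      using nth_smallest_unique[of n "\<lambda>i. i" "{1..n}" i] True by (auto simp: strict_mono_on_def)
    ultimately show ?thesis by simp
  next
    case False
    then show ?thesis using assms(1) by (simp add: permutes_not_in)
  qed
qed

section \<open>Permutations with one descent as subsets\<close>

text \<open>The Grassmannian permutation of \<open>A\<close>: the candidate inverse to sending a
  permutation with sole descent \<open>d\<close> to its image of \<open>{1..d}\<close>.\<close>

definition segment_perm :: "nat \<Rightarrow> nat set \<Rightarrow> nat \<Rightarrow> nat" where
  "segment_perm n A i =
    (if i \<in> {1..card A} then nth_smallest A i
     else if i \<in> {card A<..n} then nth_smallest ({1..n} - A) (i - card A)
     else i)"

lemma card_complement:
  assumes "A \<subseteq> {1..n}"
  shows "card A \<le> n" "card ({1..n} - A) = n - card A"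
  using card_mono[OF _ assms] card_Diff_subset[OF _ assms] finite_subset[OF assms] by auto

lemma segment_perm_bij:
  assumes "A \<subseteq> {1..n}"
  shows "bij_betw (segment_perm n A) {1..card A} A"
    and "bij_betw (segment_perm n A) {card A<..n} ({1..n} - A)"
proof -
  have fin: "finite A" using assms finite_subset by blast
  show "bij_betw (segment_perm n A) {1..card A} A"
    using bij_betw_nth_smallest[OF fin]
    by (rule iffD1[OF bij_betw_cong, rotated]) (simp add: segment_perm_def)
  \<comment> \<open>The second block starts at position \<open>card A + 1\<close>; the shift makes
    it start at 1, as \<open>nth_smallest\<close> expects.\<close>
  have "bij_betw (\<lambda>i. i - card A) {card A<..n} {1..n - card A}"
    using card_complement[OF assms]
    by (intro bij_betw_byWitness[where f' = "\<lambda>i. i + card A"]) auto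
  moreover have "bij_betw (nth_smallest ({1..n} - A)) {1..n - card A} ({1..n} - A)"
    using bij_betw_nth_smallest[of "{1..n} - A"] card_complement[OF assms] by simp
  ultimately have "bij_betw (nth_smallest ({1..n} - A) \<circ> (\<lambda>i. i - card A)) {card A<..n} ({1..n} - A)"
    by (rule bij_betw_trans)
  then show "bij_betw (segment_perm n A) {card A<..n} ({1..n} - A)"
    by (rule iffD1[OF bij_betw_cong, rotated]) (simp add: segment_perm_def)
qed

lemma segment_perm_permutes:
  assumes "A \<subseteq> {1..n}"
  shows "segment_perm n A permutes {1..n}"
proof (rule bij_imp_permutes)
  have "{1..card A} \<union> {card A<..n} = {1..n}" "A \<union> ({1..n} - A) = {1..n}"
    using assms card_complement[OF assms] by auto
  then show "bij_betw (segment_perm n A) {1..n} {1..n}"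
    using bij_betw_combine[OF segment_perm_bij[OF assms]] by auto
  show "segment_perm n A i = i" if "i \<notin> {1..n}" for i
    using that card_complement[OF assms] by (auto simp: segment_perm_def)
qed

text \<open>The values increase inside each of the two blocks, so only the junction between them can
  be a descent.\<close>

lemma descents_segment_perm_subset:
  assumes "A \<subseteq> {1..n}"
  shows "descents n (segment_perm n A) \<subseteq> {card A}"
proof
  fix i assume i: "i \<in> descents n (segment_perm n A)"
  have fin: "finite A" using assms finite_subset by blast
  show "i \<in> {card A}"
  proof (rule ccontr)
    assume "i \<notin> {card A}"
    then consider "i < card A" | "i > card A" by force
    then have "segment_perm n A i < segment_perm n A (i + 1)"
    proof cases
      case 1
      then show ?thesis
        using nth_smallest_less[OF fin, of i "i + 1"] i
        by (auto simp: segment_perm_def descents_def)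
    next
      case 2
      have "i < n" using i by (simp add: descents_def)
      then have "nth_smallest ({1..n} - A) (i - card A) < nth_smallest ({1..n} - A) (i + 1 - card A)"
        using 2 by (intro nth_smallest_less) (simp_all only: card_complement(2)[OF assms], auto)
      then show ?thesis
        using 2 \<open>i < n\<close> by (simp add: segment_perm_def)
    qed
    then show False using i by (simp add: descents_def)
  qed
qed

text \<open>Without a descent at the junction the permutation is the identity, and then
  \<open>A\<close>, the image of the first \<open>card A\<close> positions, is an initial
  segment.\<close>

lemma descents_segment_perm:
  assumes "A \<subseteq> {1..n}" "A \<notin> (\<lambda>k. {1..k}) ` {..n}"
  shows "descents n (segment_perm n A) = {card A}"
proof (rule ccontr)
  assume "descents n (segment_perm n A) \<noteq> {card A}"
  then have "descents n (segment_perm n A) = {}"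
    using descents_segment_perm_subset[OF assms(1)] by blast
  then have "strict_mono_on {1..n} (segment_perm n A)"
    using permutes_ascent_iff[OF segment_perm_permutes[OF assms(1)]]
    by (intro strict_mono_on_atLeastAtMost_Suc) (auto simp: descents_def)
  then have "segment_perm n A = id"
    using strict_mono_on_permutes_id segment_perm_permutes[OF assms(1)] by blast
  then have "A = {1..card A}"
    using segment_perm_bij(1)[OF assms(1)] by (simp add: bij_betw_def)
  then show False
    using assms card_complement[OF assms(1)] by blast
qed

text \<open>Up to \<open>d\<close> and after \<open>d\<close> the values of \<open>p\<close>
  increase, so they list \<open>A\<close> and its complement in order. As \<open>card A = d\<close>,
  the blocks of \<open>segment_perm n A\<close> are the same.\<close>

lemma one_descent_eq_segment_perm:
  assumes p: "p permutes {1..n}" and d: "descents n p = {d}"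
  defines "A \<equiv> p ` {1..d}"
  shows "A \<subseteq> {1..n}" "A \<notin> (\<lambda>k. {1..k}) ` {..n}" "segment_perm n A = p"
proof -
  have dn: "1 \<le> d" "d < n" and desc: "p d > p (d + 1)"
    using d unfolding descents_def by auto
  have inj: "inj p" using p by (rule permutes_inj)
  have asc: "p i < p (Suc i)" if "1 \<le> i" "i < n" "i \<noteq> d" for i
    using that d permutes_ascent_iff[OF p] by (auto simp: descents_def)
  have cardA: "card A = d"
    unfolding A_def using card_image[OF inj_on_subset[OF inj]] by simp
  show sub: "A \<subseteq> {1..n}"
    unfolding A_def using permutes_image[OF p] dn by force
  show "A \<notin> (\<lambda>k. {1..k}) ` {..n}"
  proof
    assume "A \<in> (\<lambda>k. {1..k}) ` {..n}"
    then have A: "A = {1..d}" using cardA by auto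
    have "p d \<in> A" unfolding A_def using dn by auto
    moreover have "p (d + 1) \<notin> A"
      unfolding A_def using inj by (auto simp: inj_image_mem_iff)
    moreover have "p (d + 1) \<in> {1..n}"
      using permutes_in_image[OF p] dn by simp
    \<comment> \<open>Here \<open>p d \<le> d < p (d + 1)\<close>, against the descent at
      \<open>d\<close>.\<close>
    ultimately show False using desc A by auto
  qed
  have compl: "(\<lambda>j. p (j + d)) ` {1..n - d} = {1..n} - A"
  proof -
    have "(\<lambda>j. j + d) ` {1..n - d} = {1..n} - {1..d}"
      using dn by (auto simp: image_iff intro!: bexI[of _ "_ - d"])
    then have "p ` (\<lambda>j. j + d) ` {1..n - d} = p ` {1..n} - p ` {1..d}"
      by (simp only: image_set_diff[OF inj])
    then show ?thesis
      unfolding image_image A_def permutes_image[OF p] .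
  qed
  have mono1: "strict_mono_on {1..d} p"
    using asc dn by (intro strict_mono_on_atLeastAtMost_Suc) auto
  \<comment> \<open>The position \<open>j + d\<close> with \<open>j \<ge> 1\<close> is never
    \<open>d\<close>, so the descent is avoided.\<close>
  have mono2: "strict_mono_on {1..n - d} (\<lambda>j. p (j + d))"
    using asc dn by (intro strict_mono_on_atLeastAtMost_Suc) auto
  show "segment_perm n A = p"
  proof
    fix i
    consider "i \<in> {1..d}" | "i \<in> {d<..n}" | "i \<notin> {1..n}"
      by fastforce
    then show "segment_perm n A i = p i"
    proof cases
      case 1
      then show ?thesis
        using nth_smallest_unique[OF mono1 meta_eq_to_obj_eq[OF A_def, symmetric]] by (simp add: segment_perm_def cardA)
    next
      case 2
      then have "i - d \<in> {1..n - d}" by auto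
      from nth_smallest_unique[OF mono2 compl this] show ?thesis
        using 2 by (simp add: segment_perm_def cardA)
    next
      case 3
      then show ?thesis
        using permutes_not_in[OF p 3] dn by (auto simp: segment_perm_def cardA)
    qed
  qed
qed

lemma eulerian_1:
  "eulerian n 1 = card (Pow {1..n} - (\<lambda>k. {1..k}) ` {..n})"
proof -
  have "bij_betw (segment_perm n) (Pow {1..n} - (\<lambda>k. {1..k}) ` {..n})
      {p. p permutes {1..n} \<and> card (descents n p) = 1}"
  proof (rule bij_betw_imageI; (rule inj_onI | intro subset_antisym subsetI))
    fix A B
    assume A: "A \<in> Pow {1..n} - (\<lambda>k. {1..k}) ` {..n}"
      and B: "B \<in> Pow {1..n} - (\<lambda>k. {1..k}) ` {..n}"
      and eq: "segment_perm n A = segment_perm n B"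
    \<comment> \<open>Both cardinalities are the position of the one common descent; the set is then
      the image of the positions up to it.\<close>
    from A B eq have "card A = card B"
      using descents_segment_perm[of A n] descents_segment_perm[of B n] by simp
    moreover have "segment_perm n A ` {1..card A} = A" "segment_perm n B ` {1..card B} = B"
      using A B by (intro bij_betw_imp_surj_on segment_perm_bij(1); blast)+
    ultimately show "A = B"
      using eq by metis
  next
    fix p assume "p \<in> segment_perm n ` (Pow {1..n} - (\<lambda>k. {1..k}) ` {..n})"
    then show "p \<in> {p. p permutes {1..n} \<and> card (descents n p) = 1}"
      using segment_perm_permutes descents_segment_perm by auto
  next
    fix p assume "p \<in> {p. p permutes {1..n} \<and> card (descents n p) = 1}"
    then obtain d where "p permutes {1..n}" "descents n p = {d}"
      by (auto simp: card_1_singleton_iff)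
    from one_descent_eq_segment_perm[OF this]
    show "p \<in> segment_perm n ` (Pow {1..n} - (\<lambda>k. {1..k}) ` {..n})"
      by (intro image_eqI[of _ _ "p ` {1..d}"]) auto
  qed
  then show ?thesis
    by (simp add: eulerian_def bij_betw_same_card)
qed

section \<open>Counting the two families of subsets\<close>

lemma card_non_initial:
  "int (card (Pow {1..n} - (\<lambda>k. {1..k}) ` {..n})) = 2 ^ n - int n - 1"
proof -
  have "inj_on (\<lambda>k::nat. {1..k}) {..n}"
    by (rule inj_on_inverseI[where g = card]) simp
  then have c: "card ((\<lambda>k. {1..k}) ` {..n}) = n + 1"
    by (simp add: card_image)
  have sub: "(\<lambda>k. {1..k}) ` {..n} \<subseteq> Pow {1..n}" by auto
  \<comment> \<open>This bound makes the subtraction of natural numbers agree with that of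
    integers.\<close>
  have "n + 1 \<le> 2 ^ n"
    using card_mono[OF _ sub] c by (simp add: card_Pow)
  then show ?thesis
    using card_Diff_subset[OF _ sub] c by (simp add: card_Pow of_nat_diff)
qed

text \<open>The excluded sets are the empty set and the singletons, \<open>card X + 1\<close> in
  number. For \<open>X = {1..n}\<close> these are as many as the initial segments, the empty one
  included.\<close>

lemma card_at_least_two:
  assumes "finite X"
  shows "int (card {I. I \<subseteq> X \<and> card I \<ge> 2}) = 2 ^ card X - int (card X) - 1"
proof -
  let ?L = "insert {} ((\<lambda>x. {x}) ` X)"
  have c: "card ?L = card X + 1"
    using assms by (subst card_insert_disjoint) (auto simp: card_image)
  have sub: "?L \<subseteq> Pow X" by auto
  have "{I. I \<subseteq> X \<and> card I \<ge> 2} = Pow X - ?L"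
  proof (intro set_eqI iffI)
    fix I assume I: "I \<in> Pow X - ?L"
    then have "finite I" using assms finite_subset by blast
    then have "card I \<noteq> 0" "card I \<noteq> 1"
      using I by (auto simp: card_1_singleton_iff)
    then show "I \<in> {I. I \<subseteq> X \<and> card I \<ge> 2}" using I by auto
  qed auto
  moreover have "card X + 1 \<le> 2 ^ card X"
    using card_mono[OF _ sub] c assms by (simp add: card_Pow)
  ultimately show ?thesis
    using card_Diff_subset[OF _ sub] c assms by (simp add: card_Pow of_nat_diff)
qed

section \<open>The second guess as a function of the wrong positions\<close>

text \<open>This is \<open>next_guess\<close> applied to the identity, with the secret permutation
  replaced by its set \<open>I\<close> of wrong positions, through which alone it enters.\<close>

definition second_guess :: "(nat \<Rightarrow> nat \<Rightarrow> nat) \<Rightarrow> nat set \<Rightarrow> nat \<Rightarrow> nat" where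
  "second_guess S I i =
    (if i \<in> I
     then nth_smallest I (inv_into {1..card I} (\<lambda>j. nth_smallest I (S (card I) j)) i)
     else i)"

lemma guess_1: "guess n S p 1 = id"
  by (simp add: guess_def)

lemma guess_2: "guess n S p 2 = second_guess S (wrong_positions n p id)"
  by (rule ext) (simp add: guess_def next_guess_def second_guess_def Let_def)

lemma wrong_positions_id: "wrong_positions n p id = {i \<in> {1..n}. p i \<noteq> i}"
  by (auto simp: wrong_positions_def correct_positions_def)

lemma correct_positions_full_iff:
  assumes "p permutes {1..n}" "g permutes {1..n}"
  shows "correct_positions n p g = {1..n} \<longleftrightarrow> g = p"
proof
  assume "correct_positions n p g = {1..n}"
  then have "g i = p i" if "i \<in> {1..n}" for i
    using that unfolding correct_positions_def by blast
  then show "g = p"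
    using assms by (metis ext permutes_not_in)
qed (auto simp: correct_positions_def)

text \<open>With \<open>e = nth_smallest I\<close> and \<open>\<sigma> = S (card I)\<close>, the map
  on \<open>I\<close> is the inverse of \<open>\<sigma>\<close> conjugated by
  \<open>e\<close>.\<close>

lemma second_guess_bij:
  assumes "finite I" "S (card I) permutes {1..card I}"
  shows "bij_betw (second_guess S I) I I"
proof -
  have "bij_betw (nth_smallest I \<circ> S (card I)) {1..card I} I"
    using permutes_imp_bij[OF assms(2)] bij_betw_nth_smallest[OF assms(1)] by (rule bij_betw_trans)
  then have "bij_betw (inv_into {1..card I} (\<lambda>j. nth_smallest I (S (card I) j))) I {1..card I}"
    by (intro bij_betw_inv_into) (simp add: comp_def)
  from bij_betw_trans[OF this bij_betw_nth_smallest[OF assms(1)]] show ?thesis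
    by (rule iffD1[OF bij_betw_cong, rotated]) (simp add: second_guess_def)
qed

lemma second_guess_permutes:
  assumes "strategy n S" "I \<subseteq> {1..n}"
  shows "second_guess S I permutes {1..n}"
proof -
  have "finite I" using assms(2) finite_subset by blast
  \<comment> \<open>A strategy says nothing about \<open>S 0\<close>, so the empty set is treated
    apart.\<close>
  moreover have "S (card I) permutes {1..card I}" if "card I \<noteq> 0"
    using assms card_complement(1)[OF assms(2)] that by (auto simp: strategy_def)
  ultimately have "bij_betw (second_guess S I) I I"
    using second_guess_bij[of I S] by (cases "card I = 0") (auto simp: bij_betw_def)
  then have "second_guess S I permutes I"
    by (rule bij_imp_permutes) (simp add: second_guess_def)
  then show ?thesis
    using assms(2) by (rule permutes_subset)
qed

text \<open>Inverting and conjugating a derangement creates no fixed point: with \<open>i\<close>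
  the image of index \<open>j\<close>, equality would force \<open>S (card I) j = j\<close>.\<close>

lemma second_guess_moves:
  assumes "finite I" "derangement (card I) (S (card I))" "i \<in> I"
  shows "second_guess S I i \<noteq> i"
proof -
  let ?f = "\<lambda>j. nth_smallest I (S (card I) j)"
  define j where "j = inv_into {1..card I} ?f i"
  have perm: "S (card I) permutes {1..card I}"
    using assms(2) by (simp add: derangement_def)
  note bij = bij_betw_nth_smallest[OF assms(1)]
  have "bij_betw ?f {1..card I} I"
    using bij_betw_trans[OF permutes_imp_bij[OF perm] bij] by (simp add: comp_def)
  then have im: "?f ` {1..card I} = I" by (simp add: bij_betw_def)
  have j: "j \<in> {1..card I}" "?f j = i"
    unfolding j_def
    using inv_into_into[of i ?f "{1..card I}"] f_inv_into_f[of i ?f "{1..card I}"] im assms(3)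
    by simp_all
  have "S (card I) j \<noteq> j" "S (card I) j \<in> {1..card I}"
    using j(1) assms(2) permutes_in_image[OF perm] by (auto simp: derangement_def)
  then have "nth_smallest I j \<noteq> ?f j"
    using j(1) bij_betw_imp_inj_on[OF bij] by (metis inj_onD)
  then show ?thesis
    using assms(3) j(2) unfolding second_guess_def j_def[symmetric] by simp
qed

section \<open>Games that end after one or two guesses\<close>

lemma guessed_in_1: "guessed_in n S 1 = {id}"
proof -
  have "ends_after n S p 1 \<longleftrightarrow> p = id" if "p permutes {1..n}" for p
    using correct_positions_full_iff[OF that permutes_id]
    by (auto simp: ends_after_def guess_1[unfolded One_nat_def])
  then show ?thesis
    by (auto simp: guessed_in_def permutes_id)
qed

text \<open>The condition \<open>p \<noteq> id\<close> says that the first guess fails; the equation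
  says that \<open>p\<close> is rebuilt from its own set of moved points.\<close>

lemma guessed_in_2:
  assumes "strategy n S"
  shows "guessed_in n S 2 =
    {p. p permutes {1..n} \<and> p \<noteq> id \<and> second_guess S (wrong_positions n p id) = p}"
proof -
  have "ends_after n S p 2 \<longleftrightarrow> p \<noteq> id \<and> second_guess S (wrong_positions n p id) = p"
    if p: "p permutes {1..n}" for p
  proof -
    have "{1..<2} = {1::nat}" by auto
    moreover have "second_guess S (wrong_positions n p id) permutes {1..n}"
      by (rule second_guess_permutes[OF assms]) (auto simp: wrong_positions_def)
    ultimately show ?thesis
      using correct_positions_full_iff[OF p] permutes_id[of "{1..n}"] guess_1[of n S p]
      by (auto simp: ends_after_def guess_2)
  qed
  then show ?thesis
    by (auto simp: guessed_in_def)
qed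

text \<open>If \<open>p\<close> moves \<open>i\<close>, then by injectivity it also moves
  \<open>p i\<close>, a second point.\<close>

lemma card_wrong_positions_ge_2:
  assumes "p permutes {1..n}" "p \<noteq> id"
  shows "card (wrong_positions n p id) \<ge> 2"
proof -
  obtain i where i: "p i \<noteq> i" using assms(2) by (auto simp: fun_eq_iff)
  have inn: "i \<in> {1..n}" using i permutes_not_in[OF assms(1)] by blast
  have "p (p i) \<noteq> p i" using i permutes_inj[OF assms(1)] by (auto dest: injD)
  then have "{i, p i} \<subseteq> wrong_positions n p id"
    using i inn permutes_in_image[OF assms(1)] unfolding wrong_positions_id by blast
  moreover have "finite (wrong_positions n p id)"
    by (simp add: wrong_positions_id)
  ultimately have "card {i, p i} \<le> card (wrong_positions n p id)"
    by (intro card_mono)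
  then show ?thesis using i by simp
qed

lemma card_guessed_in_2:
  assumes "strategy n S" "\<forall>k\<in>{2..n}. derangement k (S k)"
  shows "card (guessed_in n S 2) = card {I. I \<subseteq> {1..n} \<and> card I \<ge> 2}"
proof -
  \<comment> \<open>The derangement hypothesis enters here: the second guess built from
    \<open>I\<close> moves all of \<open>I\<close> and nothing else.\<close>
  have wrong: "wrong_positions n (second_guess S I) id = I"
    if I: "I \<subseteq> {1..n}" "card I \<ge> 2" for I
  proof -
    have "second_guess S I i \<noteq> i" if "i \<in> I" for i
      using second_guess_moves[of I S i] assms(2) I that finite_subset[OF I(1)]
        card_complement(1)[OF I(1)] by simp
    moreover have "second_guess S I i = i" if "i \<notin> I" for i
      using that by (simp add: second_guess_def)
    ultimately show ?thesis
      using I(1) unfolding wrong_positions_id by blast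
  qed
  have "bij_betw (\<lambda>p. wrong_positions n p id) (guessed_in n S 2) {I. I \<subseteq> {1..n} \<and> card I \<ge> 2}"
  proof (rule bij_betw_byWitness[where f' = "second_guess S"])
    show "\<forall>p\<in>guessed_in n S 2. second_guess S (wrong_positions n p id) = p"
      by (simp add: guessed_in_2[OF assms(1)])
    show "\<forall>I\<in>{I. I \<subseteq> {1..n} \<and> card I \<ge> 2}. wrong_positions n (second_guess S I) id = I"
      using wrong by simp
    show "(\<lambda>p. wrong_positions n p id) ` guessed_in n S 2 \<subseteq> {I. I \<subseteq> {1..n} \<and> card I \<ge> 2}"
      using card_wrong_positions_ge_2
      by (auto simp: guessed_in_2[OF assms(1)]) (auto simp: wrong_positions_def)
    show "second_guess S ` {I. I \<subseteq> {1..n} \<and> card I \<ge> 2} \<subseteq> guessed_in n S 2"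
    proof (rule image_subsetI)
      fix I assume "I \<in> {I. I \<subseteq> {1..n} \<and> card I \<ge> 2}"
      then have I: "I \<subseteq> {1..n}" "card I \<ge> 2" by auto
      \<comment> \<open>The identity would be found at the first guess; it moves no point, while
        \<open>I\<close> is nonempty.\<close>
      have "second_guess S I \<noteq> id"
      proof
        assume "second_guess S I = id"
        then have "I = {}" using wrong[OF I] by (simp add: wrong_positions_id)
        then show False using I(2) by simp
      qed
      then show "second_guess S I \<in> guessed_in n S 2"
        using wrong[OF I] second_guess_permutes[OF assms(1) I(1)]
        by (simp add: guessed_in_2[OF assms(1)])
    qed
  qed
  then show ?thesis by (rule bij_betw_same_card)
qed

theorem theorem4p1:
  fixes n :: nat and S :: "nat \<Rightarrow> nat \<Rightarrow> nat"
  assumes "n \<ge> 1"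
    and "strategy n S"
    and "\<forall>k\<in>{2..n}. derangement k (S k)"
  shows "fps_nth (strategy_gf n S) 1 = 1
    \<and> fps_nth (strategy_gf n S) 2 = int (eulerian n 1)
    \<and> int (eulerian n 1) = 2 ^ n - int n - 1
    \<and> card (guessed_in n S 1) = 1
    \<and> int (card (guessed_in n S 2)) = 2 ^ n - int n - 1"
proof -
  have one: "card (guessed_in n S 1) = 1"
    unfolding guessed_in_1 by simp
  have two: "int (card (guessed_in n S 2)) = 2 ^ n - int n - 1"
    using card_guessed_in_2[OF assms(2,3)] card_at_least_two[of "{1..n}"] by simp
  \<comment> \<open>The Eulerian number and the number of two-guess games are compared through their
    common value.\<close>
  have eul: "int (eulerian n 1) = 2 ^ n - int n - 1"
    unfolding eulerian_1 by (rule card_non_initial)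
  show ?thesis
    using one two eul unfolding strategy_gf_def fps_nth_Abs_fps by simp
qed

end
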